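(* Let $\Gamma$ be the zero-sum repeated game with one informed player described in the context, and let $v_\lambda(1)$ be the value of its $\lambda$-discounted game with initial state $1$. Then $(v_\lambda(1))$ does not converge when $\lambda\to0$.
   Context: The game has finite state space $K$, finite action sets $I$ (Player 1), $J$ (Player 2), transition $q:K\times I\times J\to\Delta(K)$, payoff $g:K\to\mathbb{R}$, all known to both players. The initial state $k_1$ is (here) a given state known to both players. At each stage $m\ge1$ the players simultaneously and independently choose $i_m\in I$, $j_m\in J$, the stage payoff is $g_m=g(k_m)$, and the next state $k_{m+1}$ is drawn from $q(k_m,i_m,j_m)$. Both players observe the past actions $(i_m,j_m)$; in addition Player 2 observes the state $k_m$ at each stage before choosing his action, while Player 1 receives no signal about the state. Behavior strategies map each player's finite private histories to probability distributions on that player's action set. For $\lambda\in(0,1]$ the $\lambda$-discounted game has payoff $\mathbb{E}\big(\sum_{m\ge1}\lambda(1-\lambda)^{m-1}g_m\big)$, maximized by Player 1 and minimized by Player 2; $v_\lambda(k)$ denotes its value when the initial state is $k$. The particular game: $K=\{1^*,1,0^*,0^{++},0^+\}$, $I=\{T,B,Q\}$, $J=\{L,R\}$. States $0^*$ and $1^*$ are absorbing. The payoff is $1$ in states $1,1^*$ and $0$ in states $0^{++},0^+,0^*$, whatever the actions. Transitions ($\alpha\cdot k+\beta\cdot k'$ means $k$ with probability $\alpha$, $k'$ with probability $\beta$; action pairs are (Player 1, Player 2)): - $1$: $(T,L)\mapsto 1$; $(T,R),(B,L)\mapsto 0^{++}$; $(B,R)\mapsto 1^*$; $(Q,L),(Q,R)\mapsto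 0^*$. - $0^{++}$: $(T,L),(B,R)\mapsto \frac12\cdot0^{++}+\frac12\cdot0^+$; $(T,R),(B,L)\mapsto 0^{++}$; $(Q,L),(Q,R)\mapsto 0^*$. - $0^+$: $(T,L),(B,R)\mapsto 0^+$; $(T,R),(B,L)\mapsto 0^{++}$; $(Q,L),(Q,R)\mapsto 1$. *)

theory Defs
  imports "HOL-Probability.Probability"
begin

text \<open>
  Zero-sum repeated games in which both players observe the past actions, Player 2 also observes
  the current state before acting, and Player 1 gets no signal about it.  A game is given by its
  transition function \<open>q\<close> and its payoff function \<open>g\<close>.
\<close>

text \<open>
  Lists of past events are in chronological order.  \<open>\<tau> h k\<close> is Player 2's mixed action
  in current state \<open>k\<close> after the past states and actions \<open>h\<close>.
\<close>

type_synonym ('i, 'j) strategy1 = "('i \<times> 'j) list \<Rightarrow> 'i pmf"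
type_synonym ('k, 'i, 'j) strategy2 = "('k \<times> 'i \<times> 'j) list \<Rightarrow> 'k \<Rightarrow> 'j pmf"

text \<open>
  A play is a sequence \<open>\<omega>\<close> with \<open>\<omega> n = (k, i, j)\<close> the state and actions at the stage
  numbered \<open>n + 1\<close> in the usual convention where stages start at 1.
\<close>

definition stage_law ::
  "('k \<Rightarrow> 'i \<Rightarrow> 'j \<Rightarrow> 'k pmf) \<Rightarrow> 'k \<Rightarrow> ('i, 'j) strategy1 \<Rightarrow> ('k, 'i, 'j) strategy2
    \<Rightarrow> nat \<Rightarrow> (nat \<Rightarrow> 'k \<times> 'i \<times> 'j) \<Rightarrow> ('k \<times> 'i \<times> 'j) pmf" where
  "stage_law q k\<^sub>1 \<sigma> \<tau> n \<omega> =
    bind_pmf (if n = 0 then return_pmf k\<^sub>1 else case \<omega> (n - 1) of (k, i, j) \<Rightarrow> q k i j) (\<lambda>k.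
    bind_pmf (\<sigma> (map (\<lambda>m. snd (\<omega> m)) [0..<n])) (\<lambda>i.
    bind_pmf (\<tau> (map \<omega> [0..<n]) k) (\<lambda>j.
    return_pmf (k, i, j))))"

text \<open>The probability on infinite plays, from the kernels \<open>stage_law\<close> by Ionescu-Tulcea.\<close>

definition play_measure ::
  "('k \<Rightarrow> 'i \<Rightarrow> 'j \<Rightarrow> 'k pmf) \<Rightarrow> 'k \<Rightarrow> ('i, 'j) strategy1 \<Rightarrow> ('k, 'i, 'j) strategy2
    \<Rightarrow> (nat \<Rightarrow> 'k \<times> 'i \<times> 'j) measure" where
  "play_measure q k\<^sub>1 \<sigma> \<tau> =
    projective_family.lim UNIV
      (Ionescu_Tulcea.CI (\<lambda>n \<omega>. measure_pmf (stage_law q k\<^sub>1 \<sigma> \<tau> n \<omega>)) (\<lambda>_. count_space UNIV))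
      (\<lambda>_. count_space UNIV)"

lemma Ionescu_Tulcea_stage_law:
  fixes q :: "'k :: finite \<Rightarrow> 'i :: finite \<Rightarrow> 'j :: finite \<Rightarrow> 'k pmf"
  shows "Ionescu_Tulcea (\<lambda>n \<omega>. measure_pmf (stage_law q k\<^sub>1 \<sigma> \<tau> n \<omega>)) (\<lambda>_. count_space UNIV)"
proof (rule Ionescu_Tulcea.intro)
  fix n :: nat and \<omega> :: "nat \<Rightarrow> 'k \<times> 'i \<times> 'j"
  have fin: "PiM {0..<n} (\<lambda>_. count_space (UNIV :: ('k \<times> 'i \<times> 'j) set))
      = count_space (PiE {0..<n} (\<lambda>_. UNIV))"
    by (rule count_space_PiM_finite) (auto simp: countable_finite)
  show "(\<lambda>\<omega>. measure_pmf (stage_law q k\<^sub>1 \<sigma> \<tau> n \<omega>))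
      \<in> measurable (PiM {0..<n} (\<lambda>_. count_space UNIV)) (subprob_algebra (count_space UNIV))"
    unfolding fin by (auto simp: measure_pmf_in_subprob_algebra)
  show "prob_space (measure_pmf (stage_law q k\<^sub>1 \<sigma> \<tau> n \<omega>))"
    by (rule prob_space_measure_pmf)
qed

lemma prob_space_play_measure:
  fixes q :: "'k :: finite \<Rightarrow> 'i :: finite \<Rightarrow> 'j :: finite \<Rightarrow> 'k pmf"
  shows "prob_space (play_measure q k\<^sub>1 \<sigma> \<tau>)"
proof -
  interpret IT: Ionescu_Tulcea "\<lambda>n \<omega>. measure_pmf (stage_law q k\<^sub>1 \<sigma> \<tau> n \<omega>)"
    "\<lambda>_. count_space UNIV"
    by (rule Ionescu_Tulcea_stage_law)
  show ?thesis
    unfolding play_measure_def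
  proof (rule prob_space_distrD)
    show "(\<lambda>\<omega>. restrict \<omega> {}) \<in> measurable IT.PF.lim (PiM {} (\<lambda>_. count_space UNIV))"
      by (simp add: measurable_cong_sets[OF IT.PF.sets_lim refl])
    show "prob_space (distr IT.PF.lim (PiM {} (\<lambda>_. count_space UNIV)) (\<lambda>\<omega>. restrict \<omega> {}))"
      unfolding IT.distr_lim[OF finite.emptyI] by (rule IT.PF.prob_space_P) auto
  qed
qed

text \<open>
  The discount factor is \<open>d\<close>, with \<open>0 < d \<le> 1\<close>: the stage numbered \<open>m\<close> (from 1) has
  weight \<open>d * (1 - d) ^ (m - 1)\<close>.
\<close>

definition discounted_payoff ::
  "('k \<Rightarrow> 'i \<Rightarrow> 'j \<Rightarrow> 'k pmf) \<Rightarrow> ('k \<Rightarrow> real) \<Rightarrow> real \<Rightarrow> 'k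
    \<Rightarrow> ('i, 'j) strategy1 \<Rightarrow> ('k, 'i, 'j) strategy2 \<Rightarrow> real" where
  "discounted_payoff q g d k\<^sub>1 \<sigma> \<tau> =
    (\<integral>\<omega>. (\<Sum>n. d * (1 - d) ^ n * g (fst (\<omega> n))) \<partial>play_measure q k\<^sub>1 \<sigma> \<tau>)"

definition is_discounted_value ::
  "('k :: finite \<Rightarrow> 'i :: finite \<Rightarrow> 'j :: finite \<Rightarrow> 'k pmf) \<Rightarrow> ('k \<Rightarrow> real) \<Rightarrow> real \<Rightarrow> 'k
    \<Rightarrow> real \<Rightarrow> bool" where
  "is_discounted_value q g d k\<^sub>1 v \<longleftrightarrow>
    v = (SUP \<sigma>. INF \<tau>. discounted_payoff q g d k\<^sub>1 \<sigma> \<tau>) \<and>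
    v = (INF \<tau>. SUP \<sigma>. discounted_payoff q g d k\<^sub>1 \<sigma> \<tau>)"

text \<open>A value is at most unique; the description below is unspecified where there is none.\<close>

definition discounted_value ::
  "('k :: finite \<Rightarrow> 'i :: finite \<Rightarrow> 'j :: finite \<Rightarrow> 'k pmf) \<Rightarrow> ('k \<Rightarrow> real) \<Rightarrow> real \<Rightarrow> 'k \<Rightarrow> real" where
  "discounted_value q g d k\<^sub>1 = (THE v. is_discounted_value q g d k\<^sub>1 v)"

text \<open>The states \<open>1\<^sup>*\<close>, \<open>1\<close>, \<open>0\<^sup>*\<close>, \<open>0\<^sup>+\<^sup>+\<close>, \<open>0\<^sup>+\<close>, in this order.\<close>

datatype state = OneStar | One | ZeroStar | ZeroPP | ZeroP

datatype action1 = T | B | Q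

datatype action2 = L | R

instance state :: finite
proof
  have "(UNIV :: state set) = {OneStar, One, ZeroStar, ZeroPP, ZeroP}"
    by (auto intro: state.exhaust)
  then show "finite (UNIV :: state set)"
    by (metis finite.emptyI finite_insert)
qed

instance action1 :: finite
proof
  have "(UNIV :: action1 set) = {T, B, Q}"
    by (auto intro: action1.exhaust)
  then show "finite (UNIV :: action1 set)"
    by (metis finite.emptyI finite_insert)
qed

instance action2 :: finite
proof
  have "(UNIV :: action2 set) = {L, R}"
    by (auto intro: action2.exhaust)
  then show "finite (UNIV :: action2 set)"
    by (metis finite.emptyI finite_insert)
qed

fun game_payoff :: "state \<Rightarrow> real" where
  "game_payoff OneStar = 1"
| "game_payoff One = 1"
| "game_payoff ZeroStar = 0"
| "game_payoff ZeroPP = 0"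
| "game_payoff ZeroP = 0"

fun game_trans :: "state \<Rightarrow> action1 \<Rightarrow> action2 \<Rightarrow> state pmf" where
  "game_trans OneStar _ _ = return_pmf OneStar"
| "game_trans ZeroStar _ _ = return_pmf ZeroStar"
| "game_trans One T L = return_pmf One"
| "game_trans One T R = return_pmf ZeroPP"
| "game_trans One B L = return_pmf ZeroPP"
| "game_trans One B R = return_pmf OneStar"
| "game_trans One Q _ = return_pmf ZeroStar"
| "game_trans ZeroPP T L = pmf_of_set {ZeroPP, ZeroP}"
| "game_trans ZeroPP B R = pmf_of_set {ZeroPP, ZeroP}"
| "game_trans ZeroPP T R = return_pmf ZeroPP"
| "game_trans ZeroPP B L = return_pmf ZeroPP"
| "game_trans ZeroPP Q _ = return_pmf ZeroStar"
| "game_trans ZeroP T L = return_pmf ZeroP"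
| "game_trans ZeroP B R = return_pmf ZeroP"
| "game_trans ZeroP T R = return_pmf ZeroPP"
| "game_trans ZeroP B L = return_pmf ZeroPP"
| "game_trans ZeroP Q _ = return_pmf One"

end

theory Submission
  imports Defs "HOL-Real_Asymp.Real_Asymp"
begin

text \<open>
  In the states \<open>0\<^sup>+\<^sup>+\<close> and \<open>0\<^sup>+\<close> Player 1 wants to match Player 2's action and Player 2 wants a
  mismatch, so both toss fair coins.  After \<open>n\<close> consecutive matches the state is
  \<open>0\<^sup>+\<^sup>+\<close> with probability \<open>2\<^sup>-\<^sup>n\<close>, which is the risk of ending in \<open>0\<^sup>*\<close> if Player 1 quits at that
  moment, and such a run takes about \<open>2\<^sup>n\<^sup>+\<^sup>1\<close> stages.  Hence a fresh zero phase is worth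
  \<open>v * max\<^sub>n c\<^sub>n\<close>, where \<open>v\<close> is the value in state \<open>1\<close> and
  \<open>c\<^sub>n \<approx> 1 - 2\<^sup>-\<^sup>n - 2\<^sup>n\<^sup>+\<^sup>1 d\<close> for discount factor \<open>d\<close> (\<open>stop_value\<close>).
  The loss \<open>1 - c\<^sub>n\<close> is of order \<open>sqrt d\<close> when \<open>2\<^sup>n\<close> is of order \<open>1 / sqrt d\<close>; since \<open>n\<close> is an
  integer, the minimal loss divided by \<open>sqrt d\<close> depends on the position of \<open>1 / sqrt d\<close> between two
  powers of 2 and oscillates as \<open>d\<close> tends to 0.  State \<open>1\<close> is a \<open>2 \<times> 2\<close> game, close to a Big
  Match, whose value exceeds that of the zero phase by about \<open>(1 - v) * sqrt d\<close>.  This gain is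
  of the same order as the loss, so \<open>v \<approx> 1 / (1 + loss / sqrt d)\<close> oscillates too: its limit is
  \<open>1/4\<close> along \<open>sqrt d = 2\<^sup>-\<^sup>m\<close>, while along \<open>sqrt d = (3/4) 2\<^sup>-\<^sup>m\<close> its lower limit is at least \<open>6/23\<close>.

  The value is computed exactly by a saddle point (\<open>discounted_value_eqI\<close>).  Player 2's optimal
  strategy depends on the current state only, and so gives away nothing about which of the two zero
  states holds; against it the payoffs of the two zero states, averaged with the weights of the
  belief after \<open>n\<close> matches, are bounded by induction on the horizon for all strategies of Player 1
  at once, which avoids any computation of posteriors (\<open>finite_payoff_upper\<close>).  Player 1's optimal
  strategy only remembers the length of the current run of matches.  Its fair coin makes matches
  independent of whatever Player 2 does, so it guarantees a bound state by state
  (\<open>finite_payoff_lower\<close>).  Both inductions run on a finite-horizon payoff with a first-stage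
  recursion, which converges to the payoff defined through the measure on infinite plays
  (\<open>finite_payoff_tendsto_discounted_payoff\<close>).
\<close>

section \<open>From the play measure to finite horizons\<close>

lemma expectation_bind_pmf_finite:
  fixes h :: "'b \<Rightarrow> real"
  assumes "finite (set_pmf p)" and "\<And>x. x \<in> set_pmf p \<Longrightarrow> finite (set_pmf (f x))"
  shows "measure_pmf.expectation (bind_pmf p f) h
    = measure_pmf.expectation p (\<lambda>x. measure_pmf.expectation (f x) h)"
  using assms
  by (subst pmf_expectation_bind[of "set_pmf p"])
    (auto simp: integral_measure_pmf[of "set_pmf p" p])

text \<open>
  The law of the stage that follows a given history.  The initial state is random, with law \<open>p\<close>:
  after one stage it is \<open>q k i j\<close>, so that deleting the first stage of a history leaves a history of
  the same kind.
\<close>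

definition next_stage ::
  "('k \<Rightarrow> 'i \<Rightarrow> 'j \<Rightarrow> 'k pmf) \<Rightarrow> 'k pmf \<Rightarrow> ('i, 'j) strategy1 \<Rightarrow> ('k, 'i, 'j) strategy2
    \<Rightarrow> ('k \<times> 'i \<times> 'j) list \<Rightarrow> ('k \<times> 'i \<times> 'j) pmf" where
  "next_stage q p \<sigma> \<tau> h =
    bind_pmf (if h = [] then p else case last h of (k, i, j) \<Rightarrow> q k i j) (\<lambda>k.
    bind_pmf (\<sigma> (map snd h)) (\<lambda>i.
    bind_pmf (\<tau> h k) (\<lambda>j.
    return_pmf (k, i, j))))"

primrec history_law ::
  "('k \<Rightarrow> 'i \<Rightarrow> 'j \<Rightarrow> 'k pmf) \<Rightarrow> 'k pmf \<Rightarrow> ('i, 'j) strategy1 \<Rightarrow> ('k, 'i, 'j) strategy2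
    \<Rightarrow> nat \<Rightarrow> ('k \<times> 'i \<times> 'j) list pmf" where
  "history_law q p \<sigma> \<tau> 0 = return_pmf []"
| "history_law q p \<sigma> \<tau> (Suc n) =
    bind_pmf (history_law q p \<sigma> \<tau> n) (\<lambda>h. map_pmf (\<lambda>x. h @ [x]) (next_stage q p \<sigma> \<tau> h))"

lemma stage_law_eq_next_stage:
  "stage_law q k \<sigma> \<tau> n \<omega> = next_stage q (return_pmf k) \<sigma> \<tau> (map \<omega> [0..<n])"
  by (simp add: stage_law_def next_stage_def last_map comp_def)

lemma next_stage_Cons:
  "next_stage q p \<sigma> \<tau> ((k, i, j) # h)
    = next_stage q (q k i j) (\<lambda>a. \<sigma> ((i, j) # a)) (\<lambda>a. \<tau> ((k, i, j) # a)) h"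
  by (simp add: next_stage_def)

text \<open>
  Histories grow at the end, as in the construction of the play measure, but payoffs are analysed by
  conditioning on the first stage; here the two decompositions are identified.
\<close>

lemma history_law_Suc_first:
  "history_law q p \<sigma> \<tau> (Suc n) = bind_pmf (next_stage q p \<sigma> \<tau> []) (\<lambda>(k, i, j).
     map_pmf (Cons (k, i, j))
       (history_law q (q k i j) (\<lambda>a. \<sigma> ((i, j) # a)) (\<lambda>a. \<tau> ((k, i, j) # a)) n))"
proof (induction n)
  case 0
  show ?case
    by (simp add: bind_return_pmf map_pmf_def case_prod_unfold)
next
  case (Suc n)
  show ?case
    by (subst history_law.simps(2), subst Suc.IH)
      (auto simp: bind_assoc_pmf case_prod_unfold bind_map_pmf map_bind_pmf next_stage_Cons
         pmf.map_comp comp_def intro!: bind_pmf_cong)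
qed

lemma finite_set_history_law:
  fixes q :: "'k :: finite \<Rightarrow> 'i :: finite \<Rightarrow> 'j :: finite \<Rightarrow> 'k pmf"
  shows "finite (set_pmf (history_law q p \<sigma> \<tau> n))"
  by (induction n) auto

lemma sets_play_measure:
  fixes q :: "'k :: finite \<Rightarrow> 'i :: finite \<Rightarrow> 'j :: finite \<Rightarrow> 'k pmf"
  shows "sets (play_measure q k \<sigma> \<tau>) = sets (PiM UNIV (\<lambda>_. count_space UNIV))"
proof -
  interpret IT: Ionescu_Tulcea "\<lambda>n \<omega>. measure_pmf (stage_law q k \<sigma> \<tau> n \<omega>)"
    "\<lambda>_. count_space UNIV"
    by (rule Ionescu_Tulcea_stage_law)
  show ?thesis
    unfolding play_measure_def by (rule IT.PF.sets_lim)
qed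

lemma measurable_history:
  fixes q :: "'k :: finite \<Rightarrow> 'i :: finite \<Rightarrow> 'j :: finite \<Rightarrow> 'k pmf"
  shows "(\<lambda>\<omega>. map \<omega> [0..<n]) \<in> measurable (play_measure q k \<sigma> \<tau>) (count_space UNIV)"
proof -
  let ?M = "\<lambda>_ :: nat. count_space (UNIV :: ('k \<times> 'i \<times> 'j) set)"
  have "PiM {0..<n} ?M = count_space (PiE {0..<n} (\<lambda>_. UNIV))"
    by (rule count_space_PiM_finite) (auto simp: countable_finite)
  then have "(\<lambda>\<omega>. map \<omega> [0..<n]) \<in> measurable (PiM {0..<n} ?M) (count_space UNIV)"
    by simp
  from measurable_compose[OF measurable_restrict_subset[of "{0..<n}" UNIV ?M] this]
  moreover have "map (restrict \<omega> {0..<n}) [0..<n] = map \<omega> [0..<n]" for \<omega> :: "nat \<Rightarrow> 'k \<times> 'i \<times> 'j"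
    by auto
  ultimately show ?thesis
    by (simp only: measurable_cong_sets[OF sets_play_measure refl] subset_UNIV simp_thms)
qed

text \<open>
  The projective limit restricts on \<open>{0..<n}\<close> to the \<open>n\<close>-fold composition of the kernels, and each
  kernel appends one stage drawn from \<open>next_stage\<close>.
\<close>

lemma distr_play_measure_history:
  fixes q :: "'k :: finite \<Rightarrow> 'i :: finite \<Rightarrow> 'j :: finite \<Rightarrow> 'k pmf"
  shows "distr (play_measure q k \<sigma> \<tau>) (count_space UNIV) (\<lambda>\<omega>. map \<omega> [0..<n])
    = measure_pmf (history_law q (return_pmf k) \<sigma> \<tau> n)"
proof -
  let ?M = "\<lambda>_ :: nat. count_space (UNIV :: ('k \<times> 'i \<times> 'j) set)"
  let ?P = "\<lambda>n. PiM {0..<n} ?M"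
  let ?l = "\<lambda>n. (\<lambda>\<omega> :: nat \<Rightarrow> 'k \<times> 'i \<times> 'j. map \<omega> [0..<n])"
  interpret IT: Ionescu_Tulcea "\<lambda>n \<omega>. measure_pmf (stage_law q k \<sigma> \<tau> n \<omega>)" ?M
    by (rule Ionescu_Tulcea_stage_law)
  have fin: "?P n = count_space (PiE {0..<n} (\<lambda>_. UNIV))" for n
    by (rule count_space_PiM_finite) (auto simp: countable_finite)
  have meas [measurable]: "?l n \<in> measurable (?P n) (count_space UNIV)" for n
    unfolding fin by simp
  have step: "distr (IT.eP n \<omega>) (count_space UNIV) (?l (Suc n))
      = measure_pmf (map_pmf (\<lambda>x. ?l n \<omega> @ [x]) (next_stage q (return_pmf k) \<sigma> \<tau> (?l n \<omega>)))"
    if "\<omega> \<in> space (?P n)" for n \<omega>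
  proof -
    have upd: "fun_upd \<omega> n \<in> measurable (measure_pmf (stage_law q k \<sigma> \<tau> n \<omega>)) (?P (Suc n))"
      using that unfolding fin by (auto simp: PiE_iff extensional_def)
    have comp: "?l (Suc n) \<circ> fun_upd \<omega> n = (\<lambda>x. ?l n \<omega> @ [x])"
      by (auto simp: fun_eq_iff)
    show ?thesis
      unfolding IT.eP_def distr_distr[OF meas upd] comp
      by (simp add: stage_law_eq_next_stage map_pmf_rep_eq)
  qed
  have C: "distr (IT.C 0 n (\<lambda>_. undefined)) (count_space UNIV) (?l n)
      = measure_pmf (history_law q (return_pmf k) \<sigma> \<tau> n)"
  proof (induction n)
    case 0
    show ?case
      by (simp add: distr_return return_pmf.rep_eq space_PiM)
  next
    case (Suc n)
    let ?C = "IT.C 0 n (\<lambda>_. undefined)"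
    have u: "(\<lambda>_. undefined) \<in> space (?P 0)"
      by (simp add: space_PiM)
    have spC: "space ?C = space (?P n)" and stC: "sets ?C = sets (?P n)"
      using IT.space_C[OF u, of n] IT.sets_C[OF u, of n] by simp_all
    have ne: "space ?C \<noteq> {}"
      using IT.prob_space_C[OF u, of n] by (rule prob_space.not_empty)
    have "distr (IT.C 0 (Suc n) (\<lambda>_. undefined)) (count_space UNIV) (?l (Suc n))
        = ?C \<bind> (\<lambda>\<omega>. distr (IT.eP n \<omega>) (count_space UNIV) (?l (Suc n)))"
      using IT.measurable_eP[of n]
      by (simp only: IT.C.simps add_0_left, subst distr_bind[OF _ ne meas])
        (simp_all add: measurable_cong_sets[OF stC refl])
    also have "\<dots> = ?C \<bind> (\<lambda>\<omega>. measure_pmf (map_pmf (\<lambda>x. ?l n \<omega> @ [x])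
        (next_stage q (return_pmf k) \<sigma> \<tau> (?l n \<omega>))))"
      by (rule bind_cong[OF refl]) (simp only: spC step)
    also have "\<dots> = distr ?C (count_space UNIV) (?l n) \<bind> (\<lambda>h. measure_pmf (map_pmf (\<lambda>x. h @ [x])
        (next_stage q (return_pmf k) \<sigma> \<tau> h)))"
      by (rule bind_distr[symmetric, where K = "count_space UNIV"])
        (use ne in \<open>simp_all add: measurable_cong_sets[OF stC refl]
          measure_pmf_in_subprob_algebra\<close>)
    finally show ?case
      by (simp add: Suc.IH measure_pmf_bind)
  qed
  have CI: "IT.CI {0..<n} = IT.C 0 n (\<lambda>_. undefined)"
  proof -
    have "IT.up_to {0..<n} = n"
      by (rule antisym) (simp add: IT.up_to_iff, use IT.up_to[of "{0..<n}"] in auto)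
    then show ?thesis
      unfolding IT.CI_def using IT.distr_C[of n n "\<lambda>_. undefined" 0] by (simp add: space_PiM)
  qed
  have restr: "(\<lambda>\<omega>. restrict \<omega> {0..<n}) \<in> measurable IT.PF.lim (?P n)"
    by (simp add: measurable_cong_sets[OF IT.PF.sets_lim refl])
  have "distr IT.PF.lim (count_space UNIV) (?l n)
      = distr (distr IT.PF.lim (?P n) (\<lambda>\<omega>. restrict \<omega> {0..<n})) (count_space UNIV) (?l n)"
    by (subst distr_distr[OF meas restr]) (auto simp: comp_def intro!: distr_cong)
  also have "\<dots> = measure_pmf (history_law q (return_pmf k) \<sigma> \<tau> n)"
    by (simp add: IT.distr_lim CI C)
  finally show ?thesis
    by (simp add: play_measure_def)
qed

text \<open>
  The payoff of the first \<open>n\<close> stages.  The continuation strategies stay arbitrary functions of the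
  remaining history, so that statements about all strategies can be proved by induction on \<open>n\<close>.
\<close>

primrec finite_payoff ::
  "('k \<Rightarrow> 'i \<Rightarrow> 'j \<Rightarrow> 'k pmf) \<Rightarrow> ('k \<Rightarrow> real) \<Rightarrow> real \<Rightarrow> nat
    \<Rightarrow> ('i, 'j) strategy1 \<Rightarrow> ('k, 'i, 'j) strategy2 \<Rightarrow> 'k \<Rightarrow> real" where
  "finite_payoff q g d 0 \<sigma> \<tau> k = 0"
| "finite_payoff q g d (Suc n) \<sigma> \<tau> k = d * g k + (1 - d) *
    measure_pmf.expectation (\<sigma> []) (\<lambda>i. measure_pmf.expectation (\<tau> [] k) (\<lambda>j.
      measure_pmf.expectation (q k i j)
        (finite_payoff q g d n (\<lambda>h. \<sigma> ((i, j) # h)) (\<lambda>h. \<tau> ((k, i, j) # h)))))"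

lemma expectation_history_law:
  fixes q :: "'k :: finite \<Rightarrow> 'i :: finite \<Rightarrow> 'j :: finite \<Rightarrow> 'k pmf"
  shows "measure_pmf.expectation (history_law q p \<sigma> \<tau> n)
      (\<lambda>h. \<Sum>m<n. d * (1 - d) ^ m * g (fst (h ! m)))
    = measure_pmf.expectation p (finite_payoff q g d n \<sigma> \<tau>)"
proof (induction n arbitrary: p \<sigma> \<tau>)
  case 0
  show ?case by simp
next
  case (Suc n)
  let ?S = "\<lambda>n h. \<Sum>m<n. d * (1 - d) ^ m * g (fst (h ! m))"
  have int: "integrable (measure_pmf p') f" if "finite (set_pmf p')"
    for p' :: "'x pmf" and f :: "'x \<Rightarrow> real"
    using that by (rule integrable_measure_pmf_finite)
  have S: "?S (Suc n) (x # h) = d * g (fst x) + (1 - d) * ?S n h" for x h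
    by (subst sum.lessThan_Suc_shift) (simp add: sum_distrib_left mult_ac)
  have "measure_pmf.expectation (history_law q p \<sigma> \<tau> (Suc n)) (?S (Suc n))
      = measure_pmf.expectation (next_stage q p \<sigma> \<tau> []) (\<lambda>(k, i, j). d * g k + (1 - d) *
          measure_pmf.expectation (q k i j)
            (finite_payoff q g d n (\<lambda>h. \<sigma> ((i, j) # h)) (\<lambda>h. \<tau> ((k, i, j) # h))))"
    unfolding history_law_Suc_first
    by (subst expectation_bind_pmf_finite)
      (auto simp: finite_set_history_law case_prod_unfold S int Suc.IH simp del: sum.lessThan_Suc
         intro!: Bochner_Integration.integral_cong)
  also have "\<dots> = measure_pmf.expectation p (finite_payoff q g d (Suc n) \<sigma> \<tau>)"
    unfolding next_stage_def
    by (simp add: expectation_bind_pmf_finite int finite_payoff.simps(2)[abs_def])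
  finally show ?case .
qed

lemma finite_payoff_tendsto_discounted_payoff:
  fixes q :: "'k :: finite \<Rightarrow> 'i :: finite \<Rightarrow> 'j :: finite \<Rightarrow> 'k pmf"
  assumes "0 < d" "d \<le> 1"
  shows "(\<lambda>n. finite_payoff q g d n \<sigma> \<tau> k) \<longlonglongrightarrow> discounted_payoff q g d k \<sigma> \<tau>"
proof -
  let ?\<mu> = "play_measure q k \<sigma> \<tau>"
  let ?S = "\<lambda>n \<omega>. \<Sum>m<n. d * (1 - d) ^ m * g (fst (\<omega> m))"
  interpret prob_space ?\<mu> by (rule prob_space_play_measure)
  obtain C where C: "\<And>k. \<bar>g k\<bar> \<le> C"
    using finite_imp_bounded[of "range g"] by (auto simp: bounded_iff)
  have eq: "finite_payoff q g d n \<sigma> \<tau> k = (\<integral>\<omega>. ?S n \<omega> \<partial>?\<mu>)" for n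
  proof -
    have "finite_payoff q g d n \<sigma> \<tau> k
        = measure_pmf.expectation (history_law q (return_pmf k) \<sigma> \<tau> n)
            (\<lambda>h. \<Sum>m<n. d * (1 - d) ^ m * g (fst (h ! m)))"
      by (simp add: expectation_history_law)
    also have "\<dots> = (\<integral>\<omega>. (\<Sum>m<n. d * (1 - d) ^ m * g (fst (map \<omega> [0..<n] ! m))) \<partial>?\<mu>)"
      unfolding distr_play_measure_history[symmetric] by (rule integral_distr[OF measurable_history]) simp
    finally show ?thesis by simp
  qed
  have summ: "summable (\<lambda>m. d * (1 - d) ^ m * C)"
    using assms by (intro summable_mult2 summable_mult summable_geometric) auto
  have b: "norm (d * (1 - d) ^ m * g x) \<le> d * (1 - d) ^ m * C" for m x
    using assms C[of x] by (auto simp: abs_mult intro!: mult_left_mono)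
  show ?thesis
    unfolding eq discounted_payoff_def
  proof (rule integral_dominated_convergence)
    show "integrable ?\<mu> (\<lambda>_. \<Sum>m. d * (1 - d) ^ m * C)" by simp
    show "AE \<omega> in ?\<mu>. (\<lambda>n. ?S n \<omega>) \<longlonglongrightarrow> (\<Sum>n. d * (1 - d) ^ n * g (fst (\<omega> n)))"
      by (intro AE_I2 summable_LIMSEQ summable_comparison_test'[OF summ] b)
    show "AE \<omega> in ?\<mu>. norm (?S n \<omega>) \<le> (\<Sum>m. d * (1 - d) ^ m * C)" for n
    proof (rule AE_I2)
      fix \<omega>
      have "norm (?S n \<omega>) \<le> (\<Sum>m<n. d * (1 - d) ^ m * C)"
        by (rule order_trans[OF norm_sum sum_mono]) (rule b)
      also have "\<dots> \<le> (\<Sum>m. d * (1 - d) ^ m * C)"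
        by (rule sum_le_suminf[OF summ]) (use b norm_ge_zero order_trans in blast)+
      finally show "norm (?S n \<omega>) \<le> (\<Sum>m. d * (1 - d) ^ m * C)" .
    qed
    have [measurable]: "(\<lambda>\<omega>. g (fst (\<omega> m))) \<in> borel_measurable ?\<mu>" for m
    proof -
      have "(\<lambda>\<omega>. \<omega> m) \<in> measurable ?\<mu> (count_space UNIV)"
        unfolding measurable_cong_sets[OF sets_play_measure refl]
        by (rule measurable_component_singleton) simp
      then show ?thesis
        by (rule measurable_compose) simp
    qed
    show "?S n \<in> borel_measurable ?\<mu>" for n by measurable
    show "(\<lambda>\<omega>. \<Sum>n. d * (1 - d) ^ n * g (fst (\<omega> n))) \<in> borel_measurable ?\<mu>" by measurable
  qed
qed

lemma expectation_finite_bounds: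
  fixes f :: "'a :: finite \<Rightarrow> real"
  shows "(\<And>x. a \<le> f x) \<Longrightarrow> a \<le> measure_pmf.expectation p f"
    and "(\<And>x. f x \<le> b) \<Longrightarrow> measure_pmf.expectation p f \<le> b"
  using integrable_measure_pmf_finite[of p f]
  by (auto intro!: measure_pmf.integral_ge_const measure_pmf.integral_le_const)

section \<open>Saddle points\<close>

lemma finite_payoff_bounded:
  fixes q :: "'k :: finite \<Rightarrow> 'i :: finite \<Rightarrow> 'j :: finite \<Rightarrow> 'k pmf"
  assumes "0 \<le> d" "d \<le> 1" "a \<le> 0" "0 \<le> b" "\<And>k. a \<le> g k" "\<And>k. g k \<le> b"
  shows "a \<le> finite_payoff q g d n \<sigma> \<tau> k \<and> finite_payoff q g d n \<sigma> \<tau> k \<le> b"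
proof (induction n arbitrary: \<sigma> \<tau> k)
  case 0
  show ?case using assms by simp
next
  case (Suc n)
  let ?E = "measure_pmf.expectation (\<sigma> []) (\<lambda>i. measure_pmf.expectation (\<tau> [] k) (\<lambda>j.
      measure_pmf.expectation (q k i j)
        (finite_payoff q g d n (\<lambda>h. \<sigma> ((i, j) # h)) (\<lambda>h. \<tau> ((k, i, j) # h)))))"
  have E: "a \<le> ?E" "?E \<le> b"
    by (auto intro!: expectation_finite_bounds simp: Suc.IH)
  have "d * a + (1 - d) * a \<le> finite_payoff q g d (Suc n) \<sigma> \<tau> k"
    unfolding finite_payoff.simps using assms E by (intro add_mono mult_left_mono) auto
  moreover have "finite_payoff q g d (Suc n) \<sigma> \<tau> k \<le> d * b + (1 - d) * b"
    unfolding finite_payoff.simps using assms E by (intro add_mono mult_left_mono) auto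
  ultimately show ?case
    by (simp add: algebra_simps)
qed

lemma discounted_payoff_bounded:
  fixes q :: "'k :: finite \<Rightarrow> 'i :: finite \<Rightarrow> 'j :: finite \<Rightarrow> 'k pmf"
  assumes "0 < d" "d \<le> 1"
  obtains C where "\<And>\<sigma> \<tau>. \<bar>discounted_payoff q g d k \<sigma> \<tau>\<bar> \<le> C"
proof -
  obtain C where C: "\<And>k. \<bar>g k\<bar> \<le> C"
    using finite_imp_bounded[of "range g"] by (auto simp: bounded_iff)
  then have g: "- C \<le> g k" "g k \<le> C" for k
    by (simp_all add: abs_le_iff minus_le_iff)
  have "0 \<le> C"
    using C order_trans[OF abs_ge_zero] by blast
  then have "\<bar>finite_payoff q g d n \<sigma> \<tau> k\<bar> \<le> C" for n \<sigma> \<tau>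
    using finite_payoff_bounded[of d "- C" C g q n \<sigma> \<tau> k] assms g by (simp add: abs_le_iff)
  then have "\<bar>discounted_payoff q g d k \<sigma> \<tau>\<bar> \<le> C" for \<sigma> \<tau>
    by (intro LIMSEQ_le_const2[OF tendsto_rabs[OF finite_payoff_tendsto_discounted_payoff[OF assms]]]) auto
  then show ?thesis by (rule that)
qed

text \<open>
  The payoffs are bounded, so the suprema and infima in the definition of the value are genuine
  and a pair of optimal strategies determines both of them.
\<close>

lemma discounted_value_eqI:
  fixes q :: "'k :: finite \<Rightarrow> 'i :: finite \<Rightarrow> 'j :: finite \<Rightarrow> 'k pmf"
  assumes d: "0 < d" "d \<le> 1"
  assumes lower: "\<And>\<tau>. v \<le> discounted_payoff q g d k \<sigma>\<^sub>0 \<tau>"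
  assumes upper: "\<And>\<sigma>. discounted_payoff q g d k \<sigma> \<tau>\<^sub>0 \<le> v"
  shows "discounted_value q g d k = v"
proof -
  let ?p = "discounted_payoff q g d k"
  obtain C where C: "\<And>\<sigma> \<tau>. \<bar>?p \<sigma> \<tau>\<bar> \<le> C"
    using discounted_payoff_bounded[OF d] by metis
  have bb: "bdd_below (range (?p \<sigma>))" for \<sigma>
    by (rule bdd_belowI[of _ "- C"]) (use C abs_le_D2 minus_le_iff in force)
  have ba: "bdd_above (range (\<lambda>\<sigma>. ?p \<sigma> \<tau>))" for \<tau>
    by (rule bdd_aboveI[of _ C]) (use C abs_le_D1 in force)
  have inf: "(INF \<tau>. ?p \<sigma> \<tau>) \<le> v" for \<sigma>
    by (rule cINF_lower2[where x = \<tau>\<^sub>0, OF bb UNIV_I]) (rule upper)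
  have sup: "v \<le> (SUP \<sigma>. ?p \<sigma> \<tau>)" for \<tau>
    by (rule cSUP_upper2[where x = \<sigma>\<^sub>0, OF ba UNIV_I]) (rule lower)
  have "(SUP \<sigma>. INF \<tau>. ?p \<sigma> \<tau>) = v"
  proof (rule antisym)
    show "(SUP \<sigma>. INF \<tau>. ?p \<sigma> \<tau>) \<le> v"
      by (rule cSUP_least) (simp_all add: inf)
    have "v \<le> (INF \<tau>. ?p \<sigma>\<^sub>0 \<tau>)"
      by (rule cINF_greatest) (simp_all add: lower)
    also have "\<dots> \<le> (SUP \<sigma>. INF \<tau>. ?p \<sigma> \<tau>)"
      by (rule cSUP_upper) (auto intro!: bdd_aboveI[of _ v] inf)
    finally show "v \<le> (SUP \<sigma>. INF \<tau>. ?p \<sigma> \<tau>)" .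
  qed
  moreover have "(INF \<tau>. SUP \<sigma>. ?p \<sigma> \<tau>) = v"
  proof (rule antisym)
    show "v \<le> (INF \<tau>. SUP \<sigma>. ?p \<sigma> \<tau>)"
      by (rule cINF_greatest) (simp_all add: sup)
    have "(INF \<tau>. SUP \<sigma>. ?p \<sigma> \<tau>) \<le> (SUP \<sigma>. ?p \<sigma> \<tau>\<^sub>0)"
      by (rule cINF_lower) (auto intro!: bdd_belowI[of _ v] sup)
    also have "\<dots> \<le> v"
      by (rule cSUP_least) (simp_all add: upper)
    finally show "(INF \<tau>. SUP \<sigma>. ?p \<sigma> \<tau>) \<le> v" .
  qed
  ultimately show ?thesis
    unfolding discounted_value_def is_discounted_value_def by auto
qed

section \<open>The zero phase as a stopping problem\<close>

lemma UNIV_action1: "UNIV = {T, B, Q}"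
  by (auto intro: action1.exhaust)

lemma UNIV_action2: "UNIV = {L, R}"
  by (auto intro: action2.exhaust)

lemma expectation_action1:
  "measure_pmf.expectation p f = pmf p T * f T + pmf p B * f B + pmf p Q * f Q"
  for f :: "action1 \<Rightarrow> real"
  using integral_measure_pmf_real[of UNIV p f, OF finite UNIV_I]
  by (simp add: UNIV_action1 mult.commute)

lemma expectation_action2:
  "measure_pmf.expectation p f = pmf p L * f L + pmf p R * f R"
  for f :: "action2 \<Rightarrow> real"
  using integral_measure_pmf_real[of UNIV p f, OF finite UNIV_I]
  by (simp add: UNIV_action2 mult.commute)

lemma pmf_action1_sum: "pmf p T + pmf p B + pmf p Q = 1"
  using expectation_action1[of p "\<lambda>_. 1"] by simp

lemma pmf_action2_sum: "pmf p L + pmf p R = 1"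
  using expectation_action2[of p "\<lambda>_. 1"] by simp

lemma expectation_zero_states:
  "measure_pmf.expectation (pmf_of_set {ZeroPP, ZeroP}) f = (f ZeroPP + f ZeroP) / 2"
  for f :: "state \<Rightarrow> real"
  by (simp add: integral_pmf_of_set)

abbreviation game_finite_payoff ::
  "real \<Rightarrow> nat \<Rightarrow> (action1, action2) strategy1
    \<Rightarrow> (state, action1, action2) strategy2 \<Rightarrow> state \<Rightarrow> real" where
  "game_finite_payoff \<equiv> finite_payoff game_trans game_payoff"

lemma game_payoff_bounds: "0 \<le> game_payoff k" "game_payoff k \<le> 1"
  by (cases k; simp)+

text \<open>
  With \<open>s = (1 - d) / 2\<close>, a player who starts in \<open>0\<^sup>+\<^sup>+\<close> and quits after the first \<open>n\<close> consecutive
  matches of fair coins gets \<open>F\<close> with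
  \<open>F = s\<^sup>n (1 - d) (1 - 2\<^sup>-\<^sup>n) v + (s + s\<^sup>2 + \<dots> + s\<^sup>n) F\<close>, where \<open>v\<close> is the value of state \<open>1\<close>.
  The solution is \<open>F = stop_value d n * v\<close>.
\<close>

definition stop_value :: "real \<Rightarrow> nat \<Rightarrow> real" where
  "stop_value d n = (1 + d) * (1 - 1 / 2 ^ n) / (1 + d * (2 / (1 - d)) ^ Suc n)"

lemma stop_value_bounds:
  assumes "0 < d" "d < 1"
  shows "0 \<le> stop_value d n" "(1 - d) * stop_value d n \<le> 1"
proof -
  let ?w = "1 - 1 / 2 ^ n :: real" and ?D = "1 + d * (2 / (1 - d)) ^ Suc n"
  have w: "0 \<le> ?w" "?w \<le> 1" by simp_all
  have D: "1 \<le> ?D" using assms by simp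
  show "0 \<le> stop_value d n"
    unfolding stop_value_def using assms w D by (intro divide_nonneg_nonneg mult_nonneg_nonneg) linarith+
  have "(1 - d) * (1 + d) \<le> 1" by (simp add: algebra_simps)
  then have "(1 - d) * (1 + d) * ?w \<le> 1 * 1"
    using w assms by (intro mult_mono) auto
  also have "\<dots> \<le> ?D" using D by simp
  finally have "(1 - d) * (1 + d) * ?w / ?D \<le> 1"
    using D by (simp only: divide_le_eq_1_pos)
  then show "(1 - d) * stop_value d n \<le> 1"
    by (simp add: stop_value_def mult.assoc)
qed

definition biased_choice :: "real \<Rightarrow> 'a \<Rightarrow> 'a \<Rightarrow> 'a pmf" where
  "biased_choice p a b = map_pmf (\<lambda>heads. if heads then a else b) (bernoulli_pmf p)"

lemma pmf_biased_choice:
  assumes "a \<noteq> b" "0 \<le> p" "p \<le> 1"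
  shows "pmf (biased_choice p a b) a = p" "pmf (biased_choice p a b) b = 1 - p"
    "c \<noteq> a \<Longrightarrow> c \<noteq> b \<Longrightarrow> pmf (biased_choice p a b) c = 0"
  using assms pmf_map_inj'[of "\<lambda>heads. if heads then a else b" "bernoulli_pmf p" True]
    pmf_map_inj'[of "\<lambda>heads. if heads then a else b" "bernoulli_pmf p" False]
  by (auto simp: biased_choice_def inj_def pmf_eq_0_set_pmf)

text \<open>
  Player 1's optimal strategy will wait for \<open>N\<close> matches; \<open>c\<close> is the worth of a fresh zero phase in
  units of the value of state \<open>1\<close>.
\<close>

locale best_stopping =
  fixes d c :: real and N :: nat
  assumes d: "0 < d" "d < 1"
    and c: "c = stop_value d N"
    and best: "\<And>n. stop_value d n \<le> c"
begin

definition t :: real where "t = sqrt d"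

text \<open>
  The value in state \<open>1\<close>: it solves the \<open>2 \<times> 2\<close> game at this state when the zero phase is
  worth \<open>c * v\<close>.  That game has a symmetric matrix, and its value equation reads
  \<open>(v - b)\<^sup>2 = d * (1 - v)\<^sup>2\<close> with \<open>b = d + (1 - d) * c * v\<close>; \<open>v_eq\<close> is its square root.
\<close>

definition v :: real where "v = t * (1 + t) / (1 - (1 - d) * c + t)"

text \<open>
  The value after a run of \<open>n\<close> matches, in units of \<open>v\<close>.  It is the solution with \<open>run_value 0 = c\<close> of
  the equation saying that Player 1 goes on after every run.  Quitting never does better
  (\<open>run_value_ge\<close>), because this is just \<open>stop_value d n \<le> c\<close>, and it does equally well after \<open>N\<close>
  matches, so that one sequence serves for both players.
\<close>

definition run_value :: "nat \<Rightarrow> real" where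
  "run_value n = c * (1 - d) * (1 + d * (2 / (1 - d)) ^ Suc n) / (1 + d)"

lemma t: "0 < t" "t < 1" "t * t = d"
  using d by (simp_all add: t_def)

lemma c_bounds: "0 \<le> c" "(1 - d) * c \<le> 1"
  using stop_value_bounds[OF d] c by auto

lemma v_eq: "v - (d + (1 - d) * (c * v)) = t * (1 - v)"
proof -
  have "v * (1 - (1 - d) * c + t) = t * (1 + t)"
    using c_bounds t unfolding v_def by simp
  then show ?thesis
    using t(3) by (simp add: algebra_simps)
qed

lemma d_le_v: "d \<le> v"
proof -
  have "d = t * t" using t by simp
  also have "\<dots> \<le> t" using mult_left_mono[of t 1 t] t by simp
  also have "t = t * (1 + t) / (1 + t)" using t by simp
  also have "\<dots> \<le> v"
    unfolding v_def using t c_bounds d by (intro divide_left_mono mult_pos_pos) (auto intro!: add_nonneg_pos)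
  finally show ?thesis .
qed

lemma v_pos: "0 < v" using d d_le_v by simp

text \<open>
  In state \<open>1\<close> both players put probability \<open>t / (1 + t)\<close> on their second action, \<open>B\<close> or \<open>R\<close>.  By
  symmetry of the matrix the two equations say both that Player 1 is indifferent between \<open>T\<close> and \<open>B\<close>
  and that Player 2 is indifferent between \<open>L\<close> and \<open>R\<close>.
\<close>

lemma One_balance:
  "d + (1 - d) * (1 / (1 + t) * v + t / (1 + t) * (c * v)) = v"
  "d + (1 - d) * (1 / (1 + t) * (c * v) + t / (1 + t)) = v"
proof -
  have b: "(1 - d) * (c * v) = v - t * (1 - v) - d"
    using v_eq by simp
  define u where "u = 1 / (1 + t)"
  have u: "u * (1 + t) = 1" using t by (simp add: u_def)
  have "d + (1 - d) * (u * v + t * u * (c * v)) = v"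
    using b u t(3) by algebra
  then show "d + (1 - d) * (1 / (1 + t) * v + t / (1 + t) * (c * v)) = v"
    by (simp add: u_def)
  have "d + (1 - d) * (u * (c * v) + t * u) = v"
    using b u t(3) by algebra
  then show "d + (1 - d) * (1 / (1 + t) * (c * v) + t / (1 + t)) = v"
    by (simp add: u_def)
qed

lemma run_value_0: "run_value 0 = c"
proof -
  have "(1 - d) * (1 + d * (2 / (1 - d)) ^ Suc 0) = 1 + d"
    using d by (simp add: field_simps)
  then show ?thesis
    using d by (simp add: run_value_def mult.assoc)
qed

lemma run_value_step: "run_value n = (1 - d) * (run_value (Suc n) + c) / 2"
proof -
  define P where "P = (2 / (1 - d)) ^ Suc n"
  define k where "k = 1 / (1 + d)"
  have k: "k * (1 + d) = 1" using d by (simp add: k_def)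
  have "run_value (Suc n) = c * ((1 - d) * (1 + d * (2 / (1 - d) * P))) * k"
    by (simp add: run_value_def P_def k_def)
  also have "(1 - d) * (1 + d * (2 / (1 - d) * P)) = 1 - d + d * 2 * P"
    using d by (simp add: field_simps)
  finally have S: "run_value (Suc n) = c * (1 - d + d * 2 * P) * k" .
  have "run_value n = c * (1 - d) * (1 + d * P) * k"
    by (simp add: run_value_def P_def k_def)
  then have "2 * run_value n = (1 - d) * (run_value (Suc n) + c)"
    using S k by algebra
  then show ?thesis by simp
qed

lemma run_value_ge: "(1 - d) * (1 - 1 / 2 ^ n) \<le> run_value n"
proof -
  let ?D = "1 + d * (2 / (1 - d)) ^ Suc n"
  have D: "0 < ?D" using d by (intro add_pos_nonneg) auto
  have "(1 - d) * (1 - 1 / 2 ^ n) = stop_value d n * ((1 - d) * ?D / (1 + d))"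
    using D d by (simp add: stop_value_def del: power_Suc)
  also have "\<dots> \<le> c * ((1 - d) * ?D / (1 + d))"
    using best D d by (intro mult_right_mono) (auto simp del: power_Suc)
  finally show ?thesis by (simp add: run_value_def mult.assoc)
qed

lemma run_value_N: "run_value N = (1 - d) * (1 - 1 / 2 ^ N)"
proof -
  let ?D = "1 + d * (2 / (1 - d)) ^ Suc N"
  have D: "0 < ?D" using d by (intro add_pos_nonneg) auto
  have "c * ?D = (1 + d) * (1 - 1 / 2 ^ N)"
    using D unfolding c stop_value_def by simp
  moreover have "run_value N = (1 - d) * (c * ?D) / (1 + d)"
    by (simp add: run_value_def mult.assoc mult.left_commute del: power_Suc)
  ultimately have "run_value N = (1 - d) * ((1 + d) * (1 - 1 / 2 ^ N)) / (1 + d)"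
    by (simp only:)
  then show ?thesis
    using d by simp
qed

subsection \<open>The optimal strategy of Player 2\<close>

text \<open>
  The two zero states are treated alike, so the actions reveal nothing about which one holds.
\<close>

definition \<tau>_opt :: "(state, action1, action2) strategy2" where
  "\<tau>_opt h k = biased_choice (if k = One then t / (1 + t) else 1 / 2) R L"

lemma pmf_\<tau>_opt:
  "pmf (\<tau>_opt h One) R = t / (1 + t)" "pmf (\<tau>_opt h One) L = 1 / (1 + t)"
  "k \<noteq> One \<Longrightarrow> pmf (\<tau>_opt h k) R = 1 / 2" "k \<noteq> One \<Longrightarrow> pmf (\<tau>_opt h k) L = 1 / 2"
  using t by (simp_all add: \<tau>_opt_def pmf_biased_choice field_simps)

lemma \<tau>_opt_shift: "(\<lambda>h. \<tau>_opt (y # h)) = \<tau>_opt"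
  by (simp add: \<tau>_opt_def fun_eq_iff)

text \<open>
  Separate bounds for the two zero states would be too weak, because in \<open>0\<^sup>+\<close> some strategy quits at
  once.  The mixture with weights \<open>2\<^sup>-\<^sup>m\<close> and \<open>1 - 2\<^sup>-\<^sup>m\<close> is the right quantity, and it reproduces
  itself: a match turns it into the mixture for \<open>m + 1\<close>, a mismatch into that for \<open>0\<close>.  Both zero states face the
  same strategy \<open>\<sigma>\<close>, which is where Player 1's ignorance of the state enters.
\<close>

lemma finite_payoff_upper:
  "game_finite_payoff d n \<sigma> \<tau>_opt OneStar \<le> 1
   \<and> game_finite_payoff d n \<sigma> \<tau>_opt ZeroStar = 0
   \<and> game_finite_payoff d n \<sigma> \<tau>_opt One \<le> v
   \<and> (\<forall>m. 1 / 2 ^ m * game_finite_payoff d n \<sigma> \<tau>_opt ZeroPP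
        + (1 - 1 / 2 ^ m) * game_finite_payoff d n \<sigma> \<tau>_opt ZeroP \<le> v * run_value m)"
proof (induction n arbitrary: \<sigma>)
  case 0
  have "0 \<le> run_value m" for m
    using run_value_ge[of m] d by (intro order_trans[OF _ run_value_ge] mult_nonneg_nonneg) auto
  then show ?case using v_pos by simp
next
  case (Suc n)
  let ?s = "\<lambda>i j h. \<sigma> ((i, j) # h)"
  let ?F = "\<lambda>i j. game_finite_payoff d n (?s i j) \<tau>_opt"
  let ?p = "pmf (\<sigma> [])"
  have IH1: "?F i j OneStar \<le> 1" and IH0: "?F i j ZeroStar = 0" and IHv: "?F i j One \<le> v"
    and IHm: "1 / 2 ^ m * ?F i j ZeroPP + (1 - 1 / 2 ^ m) * ?F i j ZeroP \<le> v * run_value m" for i j m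
    using Suc.IH[of "?s i j"] by blast+
  have IHc: "?F i j ZeroPP \<le> c * v" for i j
    using IHm[of 0 i j] by (simp add: run_value_0 mult.commute)
  note psum = pmf_action1_sum[of "\<sigma> []"]
  have r: "0 \<le> 1 - d" using d by simp
  have "game_finite_payoff d (Suc n) \<sigma> \<tau>_opt OneStar \<le> 1"
    using finite_payoff_bounded[of d 0 1 game_payoff game_trans "Suc n" \<sigma> \<tau>_opt OneStar] d game_payoff_bounds
    by simp
  moreover have "game_finite_payoff d (Suc n) \<sigma> \<tau>_opt ZeroStar = 0"
    by (simp add: \<tau>_opt_shift IH0)
  moreover have "game_finite_payoff d (Suc n) \<sigma> \<tau>_opt One \<le> v"
  proof -
    let ?a = "1 / (1 + t)" and ?b = "t / (1 + t)"
    have ab: "0 \<le> ?a" "0 \<le> ?b" using t by simp_all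
    have "d + (1 - d) * (?a * ?F T L One + ?b * ?F T R ZeroPP)
        \<le> d + (1 - d) * (?a * v + ?b * (c * v))"
      using ab r IHv IHc by (intro add_mono mult_left_mono order_refl)
    then have T: "d + (1 - d) * (?a * ?F T L One + ?b * ?F T R ZeroPP) \<le> v"
      using One_balance by simp
    have "d + (1 - d) * (?a * ?F B L ZeroPP + ?b * ?F B R OneStar)
        \<le> d + (1 - d) * (?a * (c * v) + ?b * 1)"
      using ab r IH1 IHc by (intro add_mono mult_left_mono order_refl)
    then have B: "d + (1 - d) * (?a * ?F B L ZeroPP + ?b * ?F B R OneStar) \<le> v"
      using One_balance by simp
    have "game_finite_payoff d (Suc n) \<sigma> \<tau>_opt One = d * (?p T + ?p B + ?p Q) + (1 - d) *
        (?p T * (?a * ?F T L One + ?b * ?F T R ZeroPP)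
         + ?p B * (?a * ?F B L ZeroPP + ?b * ?F B R OneStar))"
      unfolding psum
      by (simp add: expectation_action1 expectation_action2 pmf_\<tau>_opt \<tau>_opt_shift IH0)
    also have "\<dots> = ?p T * (d + (1 - d) * (?a * ?F T L One + ?b * ?F T R ZeroPP))
        + ?p B * (d + (1 - d) * (?a * ?F B L ZeroPP + ?b * ?F B R OneStar)) + ?p Q * d"
      by algebra
    also have "\<dots> \<le> ?p T * v + ?p B * v + ?p Q * v"
      using T B d_le_v by (intro add_mono mult_left_mono) auto
    also have "\<dots> = v"
      using psum by algebra
    finally show ?thesis .
  qed
  moreover have "1 / 2 ^ m * game_finite_payoff d (Suc n) \<sigma> \<tau>_opt ZeroPP
        + (1 - 1 / 2 ^ m) * game_finite_payoff d (Suc n) \<sigma> \<tau>_opt ZeroP \<le> v * run_value m" for m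
  proof -
    define w :: real where "w = 1 / 2 ^ m"
    have w: "0 \<le> 1 - w" by (simp add: w_def)
    let ?M = "\<lambda>i j. w / 2 * ?F i j ZeroPP + (1 - w / 2) * ?F i j ZeroP"
    have M: "?M i j \<le> v * run_value (Suc m)" for i j
      using IHm[of "Suc m" i j] by (simp add: w_def mult.commute)
    \<comment> \<open>A match, which has probability one half, replaces the weight \<open>w\<close> of \<open>0\<^sup>+\<^sup>+\<close> by \<open>w / 2\<close>.\<close>
    have PP: "game_finite_payoff d (Suc n) \<sigma> \<tau>_opt ZeroPP = (1 - d) *
        (?p T * (((?F T L ZeroPP + ?F T L ZeroP) / 2 + ?F T R ZeroPP) / 2)
         + ?p B * (((?F B R ZeroPP + ?F B R ZeroP) / 2 + ?F B L ZeroPP) / 2))"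
      by (simp add: expectation_action1 expectation_action2 pmf_\<tau>_opt \<tau>_opt_shift IH0
          expectation_zero_states algebra_simps add_divide_distrib)
    have P: "game_finite_payoff d (Suc n) \<sigma> \<tau>_opt ZeroP = (1 - d) *
        (?p T * ((?F T L ZeroP + ?F T R ZeroPP) / 2)
         + ?p B * ((?F B R ZeroP + ?F B L ZeroPP) / 2) + ?p Q * ((?F Q L One + ?F Q R One) / 2))"
      by (simp add: expectation_action1 expectation_action2 pmf_\<tau>_opt \<tau>_opt_shift IH0
          algebra_simps add_divide_distrib)
    have "w * game_finite_payoff d (Suc n) \<sigma> \<tau>_opt ZeroPP
        + (1 - w) * game_finite_payoff d (Suc n) \<sigma> \<tau>_opt ZeroP = (1 - d) *
        (?p T * ((?M T L + ?F T R ZeroPP) / 2) + ?p B * ((?M B R + ?F B L ZeroPP) / 2)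
         + ?p Q * ((1 - w) * ((?F Q L One + ?F Q R One) / 2)))"
      unfolding PP P by (simp add: field_simps)
    also have "\<dots> \<le> (1 - d) * (?p T * ((v * run_value (Suc m) + c * v) / 2)
         + ?p B * ((v * run_value (Suc m) + c * v) / 2)
         + ?p Q * ((1 - w) * ((v + v) / 2)))"
      using M IHc IHv w r by (intro mult_left_mono add_mono divide_right_mono) auto
    also have "\<dots> = v * (?p T * run_value m + ?p B * run_value m + ?p Q * ((1 - d) * (1 - w)))"
      by (simp add: run_value_step[of m] field_simps)
    also have "\<dots> \<le> v * (?p T * run_value m + ?p B * run_value m + ?p Q * run_value m)"
      using run_value_ge[of m] v_pos by (intro mult_left_mono add_mono) (auto simp: w_def)
    also have "\<dots> = v * run_value m"
      using psum by algebra
    finally show ?thesis by (simp add: w_def)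
  qed
  ultimately show ?case by blast
qed

subsection \<open>The optimal strategy of Player 1\<close>

text \<open>
  Player 1's memory, updated by the observed actions: \<open>None\<close> while he believes to be in state \<open>1\<close>, and
  \<open>Some n\<close> in the zero phase after a run of \<open>n\<close> matches.  The memory misjudges the state
  only after absorption, when actions no longer matter.
\<close>

fun next_memory :: "nat option \<Rightarrow> action1 \<times> action2 \<Rightarrow> nat option" where
  "next_memory None (T, R) = Some 0"
| "next_memory None (B, L) = Some 0"
| "next_memory None _ = None"
| "next_memory (Some n) (T, L) = Some (Suc n)"
| "next_memory (Some n) (B, R) = Some (Suc n)"
| "next_memory (Some n) (T, R) = Some 0"
| "next_memory (Some n) (B, L) = Some 0"
| "next_memory (Some n) (Q, _) = None"

definition memory_action :: "nat option \<Rightarrow> action1 pmf" where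
  "memory_action a = (case a of
       None \<Rightarrow> biased_choice (t / (1 + t)) B T
     | Some n \<Rightarrow> if n < N then biased_choice (1 / 2) B T else return_pmf Q)"

definition \<sigma>_opt :: "nat option \<Rightarrow> (action1, action2) strategy1" where
  "\<sigma>_opt a h = memory_action (foldl next_memory a h)"

lemma \<sigma>_opt_shift: "(\<lambda>h. \<sigma>_opt a (y # h)) = \<sigma>_opt (next_memory a y)"
  by (simp add: \<sigma>_opt_def fun_eq_iff)

lemma pmf_\<sigma>_opt:
  "pmf (\<sigma>_opt None []) B = t / (1 + t)" "pmf (\<sigma>_opt None []) T = 1 / (1 + t)"
  "pmf (\<sigma>_opt None []) Q = 0"
  "n < N \<Longrightarrow> pmf (\<sigma>_opt (Some n) []) B = 1 / 2" "n < N \<Longrightarrow> pmf (\<sigma>_opt (Some n) []) T = 1 / 2"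
  "n < N \<Longrightarrow> pmf (\<sigma>_opt (Some n) []) Q = 0" "\<sigma>_opt (Some N) [] = return_pmf Q"
  using t by (simp_all add: \<sigma>_opt_def memory_action_def pmf_biased_choice field_simps)

text \<open>
  The advantage of \<open>0\<^sup>+\<close> over \<open>0\<^sup>+\<^sup>+\<close> after a run of \<open>n\<close> matches when Player 1 waits for \<open>N\<close>.  At the end of the run it
  is the value of quitting in \<open>0\<^sup>+\<close>.  Going one match back divides it by 4 (besides discounting),
  because it survives only if the stage is a match that leaves \<open>0\<^sup>+\<^sup>+\<close> in place.
\<close>

definition gap :: "nat \<Rightarrow> real" where
  "gap n = (1 - d) * v * ((1 - d) / 4) ^ (N - n)"

lemma gap_step: "n < N \<Longrightarrow> gap n = (1 - d) / 4 * gap (Suc n)"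
  by (simp add: gap_def Suc_diff_Suc[symmetric] del: Suc_diff_Suc)

lemma gap_bounds: "0 \<le> gap n" "gap n \<le> v"
proof -
  have "(1 - d) * v * ((1 - d) / 4) ^ (N - n) \<le> 1 * v * 1"
    using d v_pos by (intro mult_mono power_le_one) auto
  then show "gap n \<le> v" by (simp add: gap_def)
  show "0 \<le> gap n"
    using d v_pos by (simp add: gap_def)
qed

lemma run_value_le_1: "n \<le> N \<Longrightarrow> run_value n \<le> 1"
proof -
  assume n: "n \<le> N"
  have "run_value n \<le> run_value N"
    unfolding run_value_def using d n c_bounds
    by (intro divide_right_mono mult_left_mono add_left_mono power_increasing) auto
  also have "\<dots> \<le> 1 * 1"
    unfolding run_value_N using d by (intro mult_mono) auto
  finally show ?thesis by simp
qed

text \<open>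
  The amount by which \<open>n\<close> stages can fall short of the guaranteed payoff: \<open>1 + 2 * v\<close> dominates all the
  lower bounds below, so that they hold for \<open>n = 0\<close>.
\<close>

definition horizon_error :: "nat \<Rightarrow> real" where
  "horizon_error n = (1 - d) ^ n * (1 + 2 * v)"

text \<open>
  Since Player 1's coin is fair, a match has probability one half against every action of Player 2,
  even an informed one.  The lower bounds can therefore be stated for each zero state separately and
  for all \<open>\<tau>\<close>; their mean with weights \<open>2\<^sup>-\<^sup>m\<close> and \<open>1 - 2\<^sup>-\<^sup>m\<close> is \<open>v * run_value m\<close> up to the error.
\<close>

lemma finite_payoff_lower:
  "1 - horizon_error n \<le> game_finite_payoff d n (\<sigma>_opt a) \<tau> OneStar
   \<and> v - horizon_error n \<le> game_finite_payoff d n (\<sigma>_opt None) \<tau> One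
   \<and> (\<forall>m\<le>N. v * run_value m - (1 - 1 / 2 ^ m) * gap m - horizon_error n
          \<le> game_finite_payoff d n (\<sigma>_opt (Some m)) \<tau> ZeroPP
        \<and> v * run_value m + 1 / 2 ^ m * gap m - horizon_error n
          \<le> game_finite_payoff d n (\<sigma>_opt (Some m)) \<tau> ZeroP)"
proof (induction n arbitrary: a \<tau>)
  case 0
  have vZ: "v * run_value m \<le> v" if "m \<le> N" for m
    using mult_left_mono[OF run_value_le_1[OF that], of v] v_pos by simp
  have g1: "1 / 2 ^ m * gap m \<le> 1 * v" for m
    using gap_bounds[of m] by (intro mult_mono) auto
  have g2: "0 \<le> (1 - 1 / 2 ^ m) * gap m" for m
    using gap_bounds[of m] by (intro mult_nonneg_nonneg) auto
  have "v * run_value m + 1 / 2 ^ m * gap m \<le> 1 + 2 * v" if "m \<le> N" for m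
    using vZ[OF that] g1[of m] v_pos by linarith
  moreover have "v * run_value m - (1 - 1 / 2 ^ m) * gap m \<le> 1 + 2 * v" if "m \<le> N" for m
    using vZ[OF that] g2[of m] v_pos by linarith
  ultimately show ?case
    using v_pos by (simp add: horizon_error_def)
next
  case (Suc n)
  let ?s = "\<lambda>a i j. \<sigma>_opt (next_memory a (i, j))"
  let ?t = "\<lambda>k i j h. \<tau> ((k, i, j) # h)"
  let ?F = "\<lambda>a k i j. game_finite_payoff d n (?s a i j) (?t k i j)"
  have horizon_error: "horizon_error (Suc n) = (1 - d) * horizon_error n"
    by (simp add: horizon_error_def)
  have r: "0 \<le> 1 - d" using d by simp
  have IH1: "1 - horizon_error n \<le> game_finite_payoff d n (\<sigma>_opt a) (?t k i j) OneStar"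
    and IHv: "v - horizon_error n \<le> game_finite_payoff d n (\<sigma>_opt None) (?t k i j) One"
    and IHpp: "m \<le> N \<Longrightarrow> v * run_value m - (1 - 1 / 2 ^ m) * gap m - horizon_error n
          \<le> game_finite_payoff d n (\<sigma>_opt (Some m)) (?t k i j) ZeroPP"
    and IHp: "m \<le> N \<Longrightarrow> v * run_value m + 1 / 2 ^ m * gap m - horizon_error n
          \<le> game_finite_payoff d n (\<sigma>_opt (Some m)) (?t k i j) ZeroP" for a k i j m
    using Suc.IH[of _ "?t k i j"] by blast+
  have IHc: "c * v - horizon_error n \<le> game_finite_payoff d n (\<sigma>_opt (Some 0)) (?t k i j) ZeroPP" for k i j
    using IHpp[of 0 k i j] by (simp add: run_value_0 mult.commute)
  have ind: "u \<le> measure_pmf.expectation p f" if "\<And>j. u \<le> f j"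
    for u and p :: "action2 pmf" and f :: "action2 \<Rightarrow> real"
    by (intro expectation_finite_bounds that)

  have "1 - horizon_error (Suc n) \<le> game_finite_payoff d (Suc n) (\<sigma>_opt a) \<tau> OneStar"
  proof -
    have "1 - horizon_error n \<le> measure_pmf.expectation (\<sigma>_opt a [])
       (\<lambda>i. measure_pmf.expectation (\<tau> [] OneStar) (\<lambda>j. ?F a OneStar i j OneStar))"
      by (intro expectation_finite_bounds IH1)
    then have "d * 1 + (1 - d) * (1 - horizon_error n) \<le> game_finite_payoff d (Suc n) (\<sigma>_opt a) \<tau> OneStar"
      using r by (simp add: \<sigma>_opt_shift mult_left_mono)
    then show ?thesis by (simp add: horizon_error algebra_simps)
  qed

  moreover have "v - horizon_error (Suc n) \<le> game_finite_payoff d (Suc n) (\<sigma>_opt None) \<tau> One"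
  proof -
    let ?a = "1 / (1 + t)" and ?b = "t / (1 + t)"
    let ?G = "\<lambda>i j. measure_pmf.expectation (game_trans One i j) (?F None One i j)"
    have ab: "0 \<le> ?a" "0 \<le> ?b" "?a + ?b = 1" using t by (simp_all add: field_simps)
    have "v - horizon_error (Suc n) \<le> d + (1 - d) * (?a * ?G T j + ?b * ?G B j)" for j
    proof (cases j)
      case L
      have "d + (1 - d) * (?a * (v - horizon_error n) + ?b * (c * v - horizon_error n))
          \<le> d + (1 - d) * (?a * ?G T j + ?b * ?G B j)"
        using ab(1,2) r IHv IHc L by (intro add_mono mult_left_mono order_refl) simp_all
      moreover have "d + (1 - d) * (?a * (v - horizon_error n) + ?b * (c * v - horizon_error n))
          = d + (1 - d) * (?a * v + ?b * (c * v)) - (1 - d) * horizon_error n * (?a + ?b)"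
        by algebra
      ultimately show ?thesis
        unfolding One_balance ab horizon_error by simp
    next
      case R
      have "d + (1 - d) * (?a * (c * v - horizon_error n) + ?b * (1 - horizon_error n))
          \<le> d + (1 - d) * (?a * ?G T j + ?b * ?G B j)"
        using ab(1,2) r IH1 IHc R by (intro add_mono mult_left_mono order_refl) simp_all
      moreover have "d + (1 - d) * (?a * (c * v - horizon_error n) + ?b * (1 - horizon_error n))
          = d + (1 - d) * (?a * (c * v) + ?b) - (1 - d) * horizon_error n * (?a + ?b)"
        by algebra
      ultimately show ?thesis
        unfolding One_balance ab horizon_error by simp
    qed
    then have "v - horizon_error (Suc n)
        \<le> measure_pmf.expectation (\<tau> [] One) (\<lambda>j. d + (1 - d) * (?a * ?G T j + ?b * ?G B j))"
      by (rule ind)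
    also have "\<dots> = d * (pmf (\<tau> [] One) L + pmf (\<tau> [] One) R)
        + (1 - d) * (?a * measure_pmf.expectation (\<tau> [] One) (?G T)
          + ?b * measure_pmf.expectation (\<tau> [] One) (?G B))"
      unfolding expectation_action2 by algebra
    also have "\<dots> = game_finite_payoff d (Suc n) (\<sigma>_opt None) \<tau> One"
      unfolding pmf_action2_sum finite_payoff.simps \<sigma>_opt_shift expectation_action1 pmf_\<sigma>_opt
      by simp
    finally show ?thesis .
  qed

  moreover have "v * run_value m - (1 - 1 / 2 ^ m) * gap m - horizon_error (Suc n)
        \<le> game_finite_payoff d (Suc n) (\<sigma>_opt (Some m)) \<tau> ZeroPP
      \<and> v * run_value m + 1 / 2 ^ m * gap m - horizon_error (Suc n)
        \<le> game_finite_payoff d (Suc n) (\<sigma>_opt (Some m)) \<tau> ZeroP" if m: "m \<le> N" for m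
  proof (cases "m = N")
    case True
    have "v * run_value m + 1 / 2 ^ m * gap m - horizon_error (Suc n) = (1 - d) * (v - horizon_error n)"
      by (simp add: True run_value_N gap_def horizon_error algebra_simps
          add_divide_distrib diff_divide_distrib)
    also have "\<dots> \<le> game_finite_payoff d (Suc n) (\<sigma>_opt (Some m)) \<tau> ZeroP"
      using r by (auto simp: True pmf_\<sigma>_opt \<sigma>_opt_shift intro!: mult_left_mono ind IHv)
    finally have "v * run_value m + 1 / 2 ^ m * gap m - horizon_error (Suc n) \<le> \<dots>" .
    moreover have "v * run_value m - (1 - 1 / 2 ^ m) * gap m = 0"
      by (simp add: True run_value_N gap_def)
    moreover have "0 \<le> horizon_error (Suc n)"
      using d v_pos by (simp add: horizon_error_def)
    moreover have "0 \<le> game_finite_payoff d (Suc n) (\<sigma>_opt (Some m)) \<tau> ZeroPP"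
      using finite_payoff_bounded[of d 0 1 game_payoff game_trans "Suc n" "\<sigma>_opt (Some m)" \<tau> ZeroPP]
        d game_payoff_bounds by simp
    ultimately show ?thesis by linarith
  next
    case False
    then have m: "m < N" using that by simp
    define w :: real where "w = 1 / 2 ^ m"
    let ?U = "v * run_value (Suc m)" and ?g = "gap (Suc m)"
    have pp: "?U - (1 - w / 2) * ?g - horizon_error n
          \<le> game_finite_payoff d n (\<sigma>_opt (Some (Suc m))) (?t k i j) ZeroPP"
      and p: "?U + w / 2 * ?g - horizon_error n
          \<le> game_finite_payoff d n (\<sigma>_opt (Some (Suc m))) (?t k i j) ZeroP" for k i j
      using IHpp[of "Suc m" k i j] IHp[of "Suc m" k i j] m by (simp_all add: w_def mult.commute)
    let ?G = "\<lambda>k i j. measure_pmf.expectation (game_trans k i j) (?F (Some m) k i j)"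
    have payoff: "game_finite_payoff d (Suc n) (\<sigma>_opt (Some m)) \<tau> k
        = measure_pmf.expectation (\<tau> [] k) (\<lambda>j. (1 - d) * ((?G k T j + ?G k B j) / 2))"
      if "game_payoff k = 0" for k
      unfolding finite_payoff.simps \<sigma>_opt_shift expectation_action1 expectation_action2
      by (simp add: pmf_\<sigma>_opt m that field_simps)
    have PP: "v * run_value m - (1 - w) * gap m - horizon_error (Suc n)
        \<le> (1 - d) * ((?G ZeroPP T j + ?G ZeroPP B j) / 2)" for j
    proof -
      let ?lo = "((?U - (1 - w / 2) * ?g - horizon_error n) + (?U + w / 2 * ?g - horizon_error n)) / 2"
      have eq: "v * run_value m - (1 - w) * gap m - horizon_error (Suc n)
          = (1 - d) * ((?lo + (c * v - horizon_error n)) / 2)"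
        unfolding gap_step[OF m] horizon_error run_value_step[of m] by (simp add: field_simps)
      have match: "?lo \<le> ?G ZeroPP i j" if "(i, j) \<in> {(T, L), (B, R)}" for i
        using add_mono[OF pp[of ZeroPP i j] p[of ZeroPP i j]] that
        by (auto simp: expectation_zero_states intro!: divide_right_mono)
      have "?lo + (c * v - horizon_error n) \<le> ?G ZeroPP T j + ?G ZeroPP B j"
        using add_mono[OF match[of T] IHc[of ZeroPP B j]] add_mono[OF match[of B] IHc[of ZeroPP T j]]
        by (cases j) (simp_all add: add.commute)
      then show ?thesis
        unfolding eq using r by (intro mult_left_mono divide_right_mono) auto
    qed
    have P: "v * run_value m + w * gap m - horizon_error (Suc n)
        \<le> (1 - d) * ((?G ZeroP T j + ?G ZeroP B j) / 2)" for j
    proof -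
      have eq: "v * run_value m + w * gap m - horizon_error (Suc n)
          = (1 - d) * (((?U + w / 2 * ?g - horizon_error n)
              + (c * v - horizon_error n)) / 2)"
        unfolding gap_step[OF m] horizon_error run_value_step[of m] by (simp add: field_simps)
      have "(?U + w / 2 * ?g - horizon_error n) + (c * v - horizon_error n) \<le> ?G ZeroP T j + ?G ZeroP B j"
        using p[of ZeroP T j] p[of ZeroP B j] IHc[of ZeroP T j] IHc[of ZeroP B j]
        by (cases j) simp_all
      then show ?thesis
        unfolding eq using r by (intro mult_left_mono divide_right_mono) auto
    qed
    show ?thesis
      unfolding payoff[OF game_payoff.simps(4)] payoff[OF game_payoff.simps(5)] w_def[symmetric]
      by (intro conjI ind PP P)
  qed
  ultimately show ?case by blast
qed

theorem discounted_value_One: "discounted_value game_trans game_payoff d One = v"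
proof (rule discounted_value_eqI)
  show d1: "0 < d" "d \<le> 1" using d by simp_all
  note lim = finite_payoff_tendsto_discounted_payoff[OF d1, of game_trans game_payoff]
  show "discounted_payoff game_trans game_payoff d One \<sigma> \<tau>_opt \<le> v" for \<sigma>
    by (rule LIMSEQ_le_const2[OF lim]) (use finite_payoff_upper in blast)
  have "(\<lambda>n. v - horizon_error n) \<longlonglongrightarrow> v - 0 * (1 + 2 * v)"
    unfolding horizon_error_def using d by (intro tendsto_intros LIMSEQ_power_zero) auto
  then show "v \<le> discounted_payoff game_trans game_payoff d One (\<sigma>_opt None) \<tau>" for \<tau>
    by (intro LIMSEQ_le[OF _ lim]) (use finite_payoff_lower in auto)
qed

end

section \<open>Oscillation of the value\<close>

lemma stop_value_maximum:
  assumes d: "0 < d" "d < 1"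
  obtains N where "\<And>n. stop_value d n \<le> stop_value d N"
proof -
  have le: "stop_value d n \<le> (1 + d) / (1 + d * 2 ^ Suc n)" for n
  proof -
    have "(2::real) ^ Suc n \<le> (2 / (1 - d)) ^ Suc n"
      using d by (intro power_mono) (auto simp: field_simps)
    then have "d * 2 ^ Suc n \<le> d * (2 / (1 - d)) ^ Suc n"
      using d by (intro mult_left_mono) auto
    moreover have "(1 + d) * (1 - 1 / 2 ^ n) \<le> (1 + d) * 1"
      using d by (intro mult_left_mono) auto
    moreover have "0 \<le> (1 + d) * (1 - 1 / 2 ^ n)"
      using d by (intro mult_nonneg_nonneg) auto
    moreover have "0 < 1 + d * 2 ^ Suc n"
      using d by (intro add_pos_nonneg) auto
    ultimately show ?thesis
      unfolding stop_value_def by (intro frac_le) auto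
  qed
  have "(\<lambda>n. (1 + d) / (1 + d * 2 ^ Suc n)) \<longlonglongrightarrow> 0"
    using d by real_asymp
  moreover have pos: "0 < stop_value d 1"
    using d by (auto simp: stop_value_def intro!: divide_pos_pos add_pos_nonneg)
  ultimately have "\<forall>\<^sub>F n in sequentially. (1 + d) / (1 + d * 2 ^ Suc n) < stop_value d 1"
    by (rule order_tendstoD)
  then obtain M where M: "\<And>n. M \<le> n \<Longrightarrow> stop_value d n < stop_value d 1"
    unfolding eventually_sequentially using le le_less_trans by blast
  let ?S = "stop_value d ` {..max M 1}"
  have "Max ?S \<in> ?S" by (rule Max_in) auto
  then obtain N where N: "stop_value d N = Max ?S" by force
  show thesis
  proof (rule that)
    fix n
    have small: "stop_value d n \<le> stop_value d N" if "n \<le> max M 1" for n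
      unfolding N using that by (intro Max_ge) auto
    show "stop_value d n \<le> stop_value d N"
    proof (cases "n \<le> max M 1")
      case False
      then have "stop_value d n < stop_value d 1" by (intro M) simp
      also have "\<dots> \<le> stop_value d N" by (rule small) simp
      finally show ?thesis by simp
    qed (rule small)
  qed
qed

text \<open>
  With \<open>y = 2\<^sup>n t\<close> the loss is about \<open>t * (1 / y + 2 * y)\<close>, and \<open>1 / y + 2 * y \<ge> 3\<close> fails only for
  \<open>1/2 < y < 1\<close>.  If \<open>t\<close> is a power of 2, then so is \<open>y\<close>, and this interval is missed.
\<close>

lemma stop_value_le_at_power_of_two:
  fixes t d :: real
  assumes t: "t = 1 / 2 ^ m" and m: "0 < m" and d: "d = t ^ 2"
  shows "(1 - d) * stop_value d n \<le> 1 - 3 * t / (1 + 4 * t)"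
proof -
  define y where "y = 2 ^ n * t"
  have t1: "0 < t" "t < 1" using t m by simp_all
  have d1: "0 < d" "d < 1" using t1 d by (simp_all add: abs_square_less_1)
  have y: "0 < y" using t1 by (simp add: y_def)
  have w: "1 / 2 ^ n = t / y" using t1 by (simp add: y_def)
  have "0 \<le> (2 * y - 1) * (y - 1)"
  proof (cases "m \<le> n")
    case True
    then have "(2::real) ^ m \<le> 2 ^ n" by simp
    then have "1 \<le> y" by (simp add: y_def t field_simps)
    then show ?thesis by simp
  next
    case False
    then have "(2::real) ^ Suc n \<le> 2 ^ m" by (intro power_increasing) auto
    then have "2 * y \<le> 1" by (simp add: y_def t field_simps)
    then show ?thesis using y by (intro mult_nonpos_nonpos) auto
  qed
  from mult_nonneg_nonneg[OF less_imp_le[OF t1(1)] this]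
  have "0 \<le> t * ((2 * y - 1) * (y - 1)) + 2 * t ^ 2 * (y ^ 2 + 2)"
    by (rule add_nonneg_nonneg) simp
  also have "\<dots> = (1 + t) * (y + 2 * t * y ^ 2) - (y - t) * (1 + 4 * t)"
    by (simp add: algebra_simps power2_eq_square)
  finally have key: "(y - t) * (1 + 4 * t) \<le> (1 + t) * (y + 2 * t * y ^ 2)" by simp
  have dy: "d * 2 ^ Suc n = 2 * t * y"
    by (simp add: d y_def power2_eq_square)
  have pw: "(2::real) ^ Suc n \<le> (2 / (1 - d)) ^ Suc n"
    using d1 by (intro power_mono) (auto simp: field_simps)
  have D: "1 + 2 * t * y \<le> 1 + d * (2 / (1 - d)) ^ Suc n"
    unfolding dy[symmetric] using d1 pw by (intro add_left_mono mult_left_mono) auto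
  have w1: "0 \<le> 1 - t / y"
    unfolding w[symmetric] by simp
  have "(1 - d) * (1 + d) \<le> 1" by (simp add: algebra_simps)
  then have num: "(1 - d) * ((1 + d) * (1 - t / y)) \<le> 1 - t / y"
    using mult_right_mono[of "(1 - d) * (1 + d)" 1 "1 - t / y"] w1 by (simp add: mult.assoc)
  have "(1 - d) * stop_value d n = (1 - d) * ((1 + d) * (1 - t / y)) / (1 + d * (2 / (1 - d)) ^ Suc n)"
    by (simp add: stop_value_def w)
  also have "\<dots> \<le> (1 - t / y) / (1 + 2 * t * y)"
    using num D w1 d1 t1 y by (intro frac_le) (auto intro!: add_pos_pos)
  also have "\<dots> = (y - t) / (y + 2 * t * y ^ 2)"
    using y by (simp add: field_simps power2_eq_square)
  also have "\<dots> \<le> (1 + t) / (1 + 4 * t)"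
  proof -
    have "0 < y + 2 * t * y ^ 2" using y t1 by (intro add_pos_pos) auto
    then show ?thesis
      using key t1 by (simp add: divide_le_eq pos_le_divide_eq mult.commute)
  qed
  also have "\<dots> = 1 - 3 * t / (1 + 4 * t)"
    using t1 by (simp add: field_simps)
  finally show ?thesis .
qed

text \<open>
  Here \<open>y = 2\<^sup>m t = 3/4\<close> lies in the interval that powers of 2 miss, and
  \<open>1 / y + 2 * y = 17/6 < 3\<close>.
\<close>

lemma stop_value_ge_at_three_quarters:
  fixes t d :: real
  assumes t: "t = 3 / 4 / 2 ^ m" and d: "d = t ^ 2"
  shows "(1 - t ^ 4) * (1 - 4 / 3 * t) / (1 + 3 / 2 * t / (1 - t)) \<le> (1 - d) * stop_value d m"
proof -
  have t1: "0 < t" "t < 1"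
    using less_le_trans[OF _ one_le_power, of "3 / 4 :: real" 2 m] unfolding t by (simp_all add: divide_less_eq)
  have d1: "0 < d" "d < 1" using t1 d by (simp_all add: abs_square_less_1)
  have w: "1 / 2 ^ m = 4 / 3 * t" using t by simp
  \<comment> \<open>The run is short compared with \<open>1 / d\<close>, so discounting during the run is negligible.\<close>
  have "real (Suc m) \<le> 2 ^ m"
    by (metis Suc_leI less_exp of_nat_le_iff of_nat_numeral of_nat_power)
  then have "real (Suc m) * t \<le> 1"
    unfolding t by (simp add: field_simps)
  then have "real (Suc m) * t * t \<le> 1 * t"
    using t1 by (intro mult_right_mono) auto
  then have "1 - t \<le> 1 + real (Suc m) * (- d)"
    by (simp add: d power2_eq_square)
  also have "\<dots> \<le> (1 - d) ^ Suc m"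
    using Bernoulli_inequality[of "- d" "Suc m"] d1 by simp
  finally have r: "1 - t \<le> (1 - d) ^ Suc m" .
  have "d * (2 / (1 - d)) ^ Suc m = 3 / 2 * t / (1 - d) ^ Suc m"
  proof -
    have *: "d * 2 ^ Suc m = 3 / 2 * t" using t by (simp add: d power2_eq_square)
    then show ?thesis by (simp only: power_divide times_divide_eq_right *)
  qed
  also have "\<dots> \<le> 3 / 2 * t / (1 - t)"
    using r t1 by (intro divide_left_mono mult_pos_pos) auto
  finally have D: "1 + d * (2 / (1 - d)) ^ Suc m \<le> 1 + 3 / 2 * t / (1 - t)" by simp
  have w1: "0 \<le> 1 - 4 / 3 * t" unfolding w[symmetric] by simp
  have "1 - t ^ 4 = (1 - d) * (1 + d)"
    by (simp add: d algebra_simps flip: power_mult power_add)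
  then have "(1 - d) * stop_value d m
      = (1 - t ^ 4) * (1 - 4 / 3 * t) / (1 + d * (2 / (1 - d)) ^ Suc m)"
    by (simp only: stop_value_def w mult.assoc times_divide_eq_right)
  also have "(1 - t ^ 4) * (1 - 4 / 3 * t) / (1 + 3 / 2 * t / (1 - t)) \<le> \<dots>"
    using D w1 d1 t1
    by (intro divide_left_mono mult_nonneg_nonneg mult_pos_pos add_pos_nonneg) (auto simp: power_le_one)
  finally show ?thesis .
qed

text \<open>
  The limits are \<open>1 / (1 + 3)\<close> and \<open>1 / (1 + 17/6)\<close>.
\<close>

lemma value_bound_limits:
  "((\<lambda>t::real. (1 + t) / (3 / (1 + 4 * t) + 1)) \<longlongrightarrow> 1 / 4) (at_right 0)"
  "((\<lambda>t::real. t * (1 + t) / (1 - (1 - t ^ 4) * (1 - 4 / 3 * t) / (1 + 3 / 2 * t / (1 - t)) + t))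
     \<longlongrightarrow> 6 / 23) (at_right 0)"
  by real_asymp+

lemma not_convergent_along_squares:
  fixes f :: "real \<Rightarrow> real"
  assumes val: "\<And>d. 0 < d \<Longrightarrow> d < 1 \<Longrightarrow> \<exists>N. (\<forall>n. stop_value d n \<le> stop_value d N)
     \<and> f d = sqrt d * (1 + sqrt d) / (1 - (1 - d) * stop_value d N + sqrt d)"
  shows "\<not> (f \<longlongrightarrow> l) (at_right 0)"
proof
  assume f: "(f \<longlongrightarrow> l) (at_right 0)"
  have seq: "filterlim (\<lambda>m. a / 2 ^ m) (at_right 0) sequentially"
    "filterlim (\<lambda>m. (a / 2 ^ m) ^ 2) (at_right 0) sequentially" if "0 < a" for a :: real
    using that by real_asymp+
  have "l \<le> 1 / 4"
  proof (rule tendsto_le)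
    show "(\<lambda>m. f ((1 / 2 ^ m) ^ 2)) \<longlonglongrightarrow> l"
      using f seq(2)[of 1] by (rule filterlim_compose) simp
    show "(\<lambda>m. (1 + 1 / 2 ^ m) / (3 / (1 + 4 * (1 / 2 ^ m)) + 1)) \<longlonglongrightarrow> (1 / 4 :: real)"
      using value_bound_limits(1) seq(1)[of 1] by (rule filterlim_compose) simp
    show "\<forall>\<^sub>F m in sequentially. f ((1 / 2 ^ m) ^ 2) \<le> (1 + 1 / 2 ^ m) / (3 / (1 + 4 * (1 / 2 ^ m)) + 1)"
      unfolding eventually_sequentially
    proof (intro exI[of _ 1] allI impI)
      fix m :: nat assume m: "1 \<le> m"
      define t d :: real where "t = 1 / 2 ^ m" and "d = t ^ 2"
      have t: "0 < t" "t < 1" using m by (simp_all add: t_def)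
      have d: "0 < d" "d < 1" using t by (simp_all add: d_def abs_square_less_1)
      obtain N where N: "f d = t * (1 + t) / (1 - (1 - d) * stop_value d N + t)"
        using val[OF d] t by (auto simp: d_def)
      have "3 * t / (1 + 4 * t) + t \<le> 1 - (1 - d) * stop_value d N + t"
        using stop_value_le_at_power_of_two[OF t_def _ d_def, of N] m by simp
      moreover have p: "0 < 3 * t / (1 + 4 * t) + t"
        using t by (intro add_pos_pos divide_pos_pos) auto
      ultimately have "f d \<le> t * (1 + t) / (3 * t / (1 + 4 * t) + t)"
        unfolding N using t by (intro divide_left_mono) auto
      also have "\<dots> = t * (1 + t) / (t * (3 / (1 + 4 * t) + 1))"
        by (simp add: algebra_simps)
      also have "\<dots> = (1 + t) / (3 / (1 + 4 * t) + 1)"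
        using t by simp
      finally show "f ((1 / 2 ^ m) ^ 2) \<le> (1 + 1 / 2 ^ m) / (3 / (1 + 4 * (1 / 2 ^ m)) + 1)"
        by (simp only: d_def t_def)
    qed
  qed simp
  moreover have "6 / 23 \<le> l"
  proof (rule tendsto_le)
    let ?h = "\<lambda>t::real. t * (1 + t) / (1 - (1 - t ^ 4) * (1 - 4 / 3 * t) / (1 + 3 / 2 * t / (1 - t)) + t)"
    show "(\<lambda>m. f ((3 / 4 / 2 ^ m) ^ 2)) \<longlonglongrightarrow> l"
      using f seq(2)[of "3 / 4"] by (rule filterlim_compose) simp
    show "(\<lambda>m. ?h (3 / 4 / 2 ^ m)) \<longlonglongrightarrow> 6 / 23"
      using value_bound_limits(2) seq(1)[of "3 / 4"] by (rule filterlim_compose) simp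
    show "\<forall>\<^sub>F m in sequentially. ?h (3 / 4 / 2 ^ m) \<le> f ((3 / 4 / 2 ^ m) ^ 2)"
    proof (rule always_eventually, rule allI)
      fix m :: nat
      define t d :: real where "t = 3 / 4 / 2 ^ m" and "d = t ^ 2"
      have t: "0 < t" "t < 1"
        using less_le_trans[OF _ one_le_power, of "3 / 4 :: real" 2 m]
        unfolding t_def by (simp_all add: divide_less_eq)
      have d: "0 < d" "d < 1" using t by (simp_all add: d_def abs_square_less_1)
      obtain N where N: "f d = t * (1 + t) / (1 - (1 - d) * stop_value d N + t)"
        and best: "\<And>n. stop_value d n \<le> stop_value d N"
        using val[OF d] t by (auto simp: d_def)
      have "(1 - t ^ 4) * (1 - 4 / 3 * t) / (1 + 3 / 2 * t / (1 - t)) \<le> (1 - d) * stop_value d m"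
        by (rule stop_value_ge_at_three_quarters[OF t_def d_def])
      also have "\<dots> \<le> (1 - d) * stop_value d N"
        using best d by (intro mult_left_mono) auto
      finally have le: "1 - (1 - d) * stop_value d N + t
        \<le> 1 - (1 - t ^ 4) * (1 - 4 / 3 * t) / (1 + 3 / 2 * t / (1 - t)) + t" by simp
      have p: "0 < 1 - (1 - d) * stop_value d N + t"
        using stop_value_bounds(2)[OF d, of N] t by simp
      have "?h t \<le> f d"
        unfolding N using t p le by (intro divide_left_mono mult_pos_pos) auto
      then show "?h (3 / 4 / 2 ^ m) \<le> f ((3 / 4 / 2 ^ m) ^ 2)"
        by (simp only: d_def t_def)
    qed
  qed simp
  ultimately show False by simp
qed

lemma discounted_value_One_formula:
  assumes d: "0 < d" "d < 1"
  shows "\<exists>N. (\<forall>n. stop_value d n \<le> stop_value d N)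
    \<and> discounted_value game_trans game_payoff d One
        = sqrt d * (1 + sqrt d) / (1 - (1 - d) * stop_value d N + sqrt d)"
proof -
  obtain N where N: "\<And>n. stop_value d n \<le> stop_value d N"
    using stop_value_maximum[OF d] by blast
  interpret best_stopping d "stop_value d N" N
    by unfold_locales (use d N in auto)
  show ?thesis
    using N discounted_value_One unfolding v_def t_def by blast
qed

theorem mainTheorem4:
  shows "\<not> (\<exists>l. ((\<lambda>d. discounted_value game_trans game_payoff d One) \<longlongrightarrow> l) (at_right 0))"
  using not_convergent_along_squares[OF discounted_value_One_formula] by blast

end
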